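(* Let $k$ be a field, let $g$ and $d$ be natural numbers, and suppose that $M\in\mathrm{Rep}_k(\mathcal{G}_g^{\mathrm{op}})$ is $d$-smallish. Then there exists a polynomial $f_M(t)\in\mathbb{Z}[t]$ of degree at most $d$ such that, for all graphs $G$ of genus $g$, $$\dim_k M(G)\le f_M(|G|).$$
   Context: A graph is a finite CW complex of dimension at most 1; 0-cells are vertices, 1-cells are edges (loops and multiple edges allowed); $|G|$ is the number of edges of $G$. The genus of a non-empty connected graph is the rank of its first homology; a "graph of genus $g$" is always non-empty and connected. A map of CW complexes between graphs is very cellular if it takes every vertex to a vertex and every edge to either a vertex or an edge. A graph morphism is an equivalence class of very cellular maps under homotopy through very cellular maps. A contraction is a surjective graph morphism with contractible fibers (it amounts to collapsing a set of edges forming a forest, followed by a graph isomorphism). $\mathcal{G}_g$ is the category of graphs of genus $g$ with contractions as morphisms, and $\mathrm{Rep}_k(\mathcal{G}_g^{\mathrm{op}})$ is the category of functors from $\mathcal{G}_g^{\mathrm{op}}$ to $k$-modules. $M$ is finitely generated in degrees $\le d$ if there are finitely many graphs $G_1,\dots,G_r$ of genus $g$, each with at most $d$ edges, and elements $v_i\in M(G_i)$ such that for every $G$, $M(G)$ is spanned by the images of the $v_i$ under the maps $M(G_i)\to M(G)$ induced by all contractions $G\to G_i$. $M$ is $d$-small if it is a subquotient of a module that is finitely generated in degrees $\le d$, and $d$-smallish if it admits a (finite) filtration by submodules, $0=M_0\subset M_1\subset\dots\subset M_m=M$, whose associated graded module is $d$-small. *)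

theory Defs
  imports
    "Graph_Theory.Digraph_Component"
    "Jordan_Normal_Form.Missing_VectorSpace"
    "HOL-Algebra.IntRing"
    "HOL-Computational_Algebra.Polynomial"
    "HOL-Library.Infinite_Typeclass"
begin

text \<open>
  A graph (a finite CW complex of dimension at most 1, loops and multiple edges allowed) is
  encoded as a \<^locale>\<open>fin_digraph\<close>: vertices are the 0-cells, arcs are the 1-cells. The
  direction of an arc only records the characteristic map of the 1-cell. It carries no further
  meaning: morphisms may reverse it, and \<^const>\<open>Digraph_Component.connected\<close> (which includes
  non-emptiness) ignores it. If \<open>'v\<close> and \<open>'e\<close> are infinite types, every finite graph is
  isomorphic to one with vertices in \<open>'v\<close> and edges in \<open>'e\<close>.
\<close>

definition chains :: "'a set \<Rightarrow> (int, 'a \<Rightarrow> int) module" where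
  "chains S = ring.func_space \<Z> S"

definition boundary :: "('v, 'e) pre_digraph \<Rightarrow> ('e \<Rightarrow> int) \<Rightarrow> ('v \<Rightarrow> int)" where
  "boundary G c = (\<lambda>v\<in>verts G. (\<Sum>a\<in>in_arcs G v. c a) - (\<Sum>a\<in>out_arcs G v. c a))"

text \<open>There are no 2-cells, so the first homology is the group of cellular 1-cycles.\<close>

definition first_homology :: "('v, 'e) pre_digraph \<Rightarrow> ('e \<Rightarrow> int) set" where
  "first_homology G =
     {c \<in> carrier (chains (arcs G)). boundary G c = \<zero>\<^bsub>chains (verts G)\<^esub>}"

definition genus :: "('v, 'e) pre_digraph \<Rightarrow> nat" where
  "genus G = Max {card B | B. finite B \<and> B \<subseteq> first_homology G \<and>
     \<not> module.lin_dep \<Z> (chains (arcs G)) B}"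

definition genus_graph :: "nat \<Rightarrow> ('v, 'e) pre_digraph \<Rightarrow> bool" where
  "genus_graph g G \<longleftrightarrow> fin_digraph G \<and> Digraph_Component.connected G \<and> genus G = g"

text \<open>
  Homotopy classes of very cellular maps are encoded by their effect on cells. An edge \<open>a\<close> goes
  to a vertex \<open>w\<close> (\<open>Inl w\<close>) or to an edge \<open>b\<close>, either along its direction (\<open>Inr (b, True)\<close>) or
  against it (\<open>Inr (b, False)\<close>). The last distinction is needed for loops, whose flip is not
  homotopic to the identity through very cellular maps.
\<close>

record ('v, 'e) graph_map =
  vmap :: "'v \<Rightarrow> 'v"
  emap :: "'e \<Rightarrow> 'v + 'e \<times> bool"

definition graph_morphism ::
  "('v, 'e) pre_digraph \<Rightarrow> ('v, 'e) pre_digraph \<Rightarrow> ('v, 'e) graph_map \<Rightarrow> bool" where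
  "graph_morphism G H \<phi> \<longleftrightarrow>
     vmap \<phi> \<in> verts G \<rightarrow>\<^sub>E verts H \<and>
     emap \<phi> \<in> arcs G \<rightarrow>\<^sub>E verts H <+> arcs H \<times> UNIV \<and>
     (\<forall>a\<in>arcs G. case emap \<phi> a of
        Inl w \<Rightarrow> vmap \<phi> (tail G a) = w \<and> vmap \<phi> (head G a) = w
      | Inr (b, s) \<Rightarrow>
          vmap \<phi> (tail G a) = (if s then tail H b else head H b) \<and>
          vmap \<phi> (head G a) = (if s then head H b else tail H b))"

definition id_map :: "('v, 'e) pre_digraph \<Rightarrow> ('v, 'e) graph_map" where
  "id_map G = \<lparr>vmap = (\<lambda>v\<in>verts G. v), emap = (\<lambda>a\<in>arcs G. Inr (a, True))\<rparr>"

definition comp_map ::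
  "('v, 'e) pre_digraph \<Rightarrow> ('v, 'e) graph_map \<Rightarrow> ('v, 'e) graph_map \<Rightarrow> ('v, 'e) graph_map" where
  "comp_map G \<psi> \<phi> =
     \<lparr>vmap = compose (verts G) (vmap \<psi>) (vmap \<phi>),
      emap = (\<lambda>a\<in>arcs G. case emap \<phi> a of
          Inl w \<Rightarrow> Inl (vmap \<psi> w)
        | Inr (b, s) \<Rightarrow> (case emap \<psi> b of
              Inl w \<Rightarrow> Inl w
            | Inr (c, t) \<Rightarrow> Inr (c, s = t)))\<rparr>"

definition vertex_fiber ::
  "('v, 'e) pre_digraph \<Rightarrow> ('v, 'e) graph_map \<Rightarrow> 'v \<Rightarrow> ('v, 'e) pre_digraph" where
  "vertex_fiber G \<phi> w =
     \<lparr>verts = {v \<in> verts G. vmap \<phi> v = w}, arcs = {a \<in> arcs G. emap \<phi> a = Inl w},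
      tail = tail G, head = head G\<rparr>"

text \<open>
  All fibers are contractible: the fiber over a vertex is a tree, i.e. a graph of genus 0, and
  the fiber over an interior point of an edge, which is a discrete set with one point for each
  edge mapping onto that edge, is a single point. Surjectivity is part of this, since
  contractible spaces are non-empty.
\<close>

definition contraction ::
  "('v, 'e) pre_digraph \<Rightarrow> ('v, 'e) pre_digraph \<Rightarrow> ('v, 'e) graph_map \<Rightarrow> bool" where
  "contraction G H \<phi> \<longleftrightarrow>
     graph_morphism G H \<phi> \<and>
     (\<forall>w\<in>verts H. genus_graph 0 (vertex_fiber G \<phi> w)) \<and>
     (\<forall>b\<in>arcs H. \<exists>!a. a \<in> arcs G \<and> (\<exists>s. emap \<phi> a = Inr (b, s)))"

text \<open>
  Functors from the opposite of the category of genus \<open>g\<close> graphs to \<open>K\<close>-modules. For a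
  contraction \<open>\<phi>\<close> from \<open>G\<close> to \<open>H\<close>, \<open>act M G H \<phi>\<close> is the induced map from \<open>ob M H\<close> to
  \<open>ob M G\<close>.
\<close>

record ('v, 'e, 'k, 'm) rep =
  ob :: "('v, 'e) pre_digraph \<Rightarrow> ('k, 'm) module"
  act :: "('v, 'e) pre_digraph \<Rightarrow> ('v, 'e) pre_digraph \<Rightarrow> ('v, 'e) graph_map \<Rightarrow> 'm \<Rightarrow> 'm"

locale contraction_rep =
  fixes K :: "('k, 'r) ring_scheme" and g :: nat and M :: "('v, 'e, 'k, 'm) rep"
  assumes ob_module: "genus_graph g G \<Longrightarrow> module K (ob M G)"
    and act_hom: "\<lbrakk>genus_graph g G; genus_graph g H; contraction G H \<phi>\<rbrakk>
      \<Longrightarrow> act M G H \<phi> \<in> module_hom K (ob M H) (ob M G)"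
    and act_id: "\<lbrakk>genus_graph g G; x \<in> carrier (ob M G)\<rbrakk> \<Longrightarrow> act M G G (id_map G) x = x"
    and act_comp: "\<lbrakk>genus_graph g G; genus_graph g H; genus_graph g L;
        contraction G H \<phi>; contraction H L \<psi>; x \<in> carrier (ob M L)\<rbrakk>
      \<Longrightarrow> act M G L (comp_map G \<psi> \<phi>) x = act M G H \<phi> (act M H L \<psi> x)"

definition subrep ::
  "('k, 'r) ring_scheme \<Rightarrow> nat \<Rightarrow> ('v, 'e, 'k, 'm) rep \<Rightarrow>
   (('v, 'e) pre_digraph \<Rightarrow> 'm set) \<Rightarrow> bool" where
  "subrep K g M S \<longleftrightarrow>
     (\<forall>G. genus_graph g G \<longrightarrow> submodule K (S G) (ob M G)) \<and>
     (\<forall>G H \<phi>. genus_graph g G \<longrightarrow> genus_graph g H \<longrightarrow> contraction G H \<phi> \<longrightarrow>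
        act M G H \<phi> ` S H \<subseteq> S G)"

definition restrict_rep ::
  "('v, 'e, 'k, 'm) rep \<Rightarrow> (('v, 'e) pre_digraph \<Rightarrow> 'm set) \<Rightarrow> ('v, 'e, 'k, 'm) rep" where
  "restrict_rep M S = \<lparr>ob = (\<lambda>G. (ob M G)\<lparr>carrier := S G\<rparr>), act = act M\<rparr>"

text \<open>
  The fields \<open>mult\<close> and \<open>one\<close> of a module record are irrelevant; they are filled with zeros, as
  in \<open>func_space\<close>.
\<close>

definition quot_module :: "('k, 'm) module \<Rightarrow> 'm set \<Rightarrow> ('k, 'm set) module" where
  "quot_module V W =
     \<lparr>carrier = a_rcosets\<^bsub>V\<^esub> W, mult = (\<lambda>X Y. W), one = W,
      zero = W, add = (\<lambda>X Y. X <+>\<^bsub>V\<^esub> Y),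
      module.smult = (\<lambda>r X. \<Union>x\<in>X. W +>\<^bsub>V\<^esub> (r \<odot>\<^bsub>V\<^esub> x))\<rparr>"

definition quot_rep ::
  "('v, 'e, 'k, 'm) rep \<Rightarrow> (('v, 'e) pre_digraph \<Rightarrow> 'm set) \<Rightarrow> ('v, 'e, 'k, 'm set) rep" where
  "quot_rep M S =
     \<lparr>ob = (\<lambda>G. quot_module (ob M G) (S G)),
      act = (\<lambda>G H \<phi> X. \<Union>x\<in>X. S G +>\<^bsub>ob M G\<^esub> act M G H \<phi> x)\<rparr>"

text \<open>The direct sum of a family of modules; only used for finite \<open>I\<close>.\<close>

definition dsum_module :: "'i set \<Rightarrow> ('i \<Rightarrow> ('k, 'm) module) \<Rightarrow> ('k, 'i \<Rightarrow> 'm) module" where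
  "dsum_module I V =
     \<lparr>carrier = (\<Pi>\<^sub>E i\<in>I. carrier (V i)),
      mult = (\<lambda>x y. \<lambda>i\<in>I. \<zero>\<^bsub>V i\<^esub>), one = (\<lambda>i\<in>I. \<zero>\<^bsub>V i\<^esub>),
      zero = (\<lambda>i\<in>I. \<zero>\<^bsub>V i\<^esub>), add = (\<lambda>x y. \<lambda>i\<in>I. x i \<oplus>\<^bsub>V i\<^esub> y i),
      module.smult = (\<lambda>r x. \<lambda>i\<in>I. r \<odot>\<^bsub>V i\<^esub> x i)\<rparr>"

definition dsum_rep :: "'i set \<Rightarrow> ('i \<Rightarrow> ('v, 'e, 'k, 'm) rep) \<Rightarrow> ('v, 'e, 'k, 'i \<Rightarrow> 'm) rep" where
  "dsum_rep I A =
     \<lparr>ob = (\<lambda>G. dsum_module I (\<lambda>i. ob (A i) G)),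
      act = (\<lambda>G H \<phi> x. \<lambda>i\<in>I. act (A i) G H \<phi> (x i))\<rparr>"

definition rep_iso ::
  "('k, 'r) ring_scheme \<Rightarrow> nat \<Rightarrow> ('v, 'e, 'k, 'm) rep \<Rightarrow> ('v, 'e, 'k, 'n) rep \<Rightarrow> bool" where
  "rep_iso K g M N \<longleftrightarrow> (\<exists>\<eta>.
     (\<forall>G. genus_graph g G \<longrightarrow>
        \<eta> G \<in> module_hom K (ob M G) (ob N G) \<and>
        bij_betw (\<eta> G) (carrier (ob M G)) (carrier (ob N G))) \<and>
     (\<forall>G H \<phi>. genus_graph g G \<longrightarrow> genus_graph g H \<longrightarrow> contraction G H \<phi> \<longrightarrow>
        (\<forall>x\<in>carrier (ob M H). \<eta> G (act M G H \<phi> x) = act N G H \<phi> (\<eta> H x))))"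

definition subquotient ::
  "('k, 'r) ring_scheme \<Rightarrow> nat \<Rightarrow> ('v, 'e, 'k, 'm) rep \<Rightarrow> ('v, 'e, 'k, 'n) rep \<Rightarrow> bool" where
  "subquotient K g M N \<longleftrightarrow> (\<exists>S T.
     subrep K g N S \<and> subrep K g N T \<and> (\<forall>G. genus_graph g G \<longrightarrow> T G \<subseteq> S G) \<and>
     rep_iso K g M (quot_rep (restrict_rep N S) T))"

definition fin_gen_deg_le ::
  "('k, 'r) ring_scheme \<Rightarrow> nat \<Rightarrow> nat \<Rightarrow> ('v, 'e, 'k, 'm) rep \<Rightarrow> bool" where
  "fin_gen_deg_le K g d M \<longleftrightarrow> (\<exists>(r::nat) Gs v.
     (\<forall>i<r. genus_graph g (Gs i) \<and> card (arcs (Gs i)) \<le> d \<and> v i \<in> carrier (ob M (Gs i))) \<and>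
     (\<forall>G. genus_graph g G \<longrightarrow>
        module.span K (ob M G) {act M G (Gs i) \<phi> (v i) | i \<phi>. i < r \<and> contraction G (Gs i) \<phi>}
          = carrier (ob M G)))"

text \<open>
  HOL cannot quantify existentially over the type \<open>'n\<close> in which the finitely generated module
  takes its values, so this type is an explicit parameter. In a theorem that has smallness as a
  hypothesis, \<open>'n\<close> is a free type variable, so the hypothesis ranges over all choices of \<open>'n\<close>.
\<close>

definition small ::
  "'n itself \<Rightarrow> ('k, 'r) ring_scheme \<Rightarrow> nat \<Rightarrow> nat \<Rightarrow> ('v, 'e, 'k, 'm) rep \<Rightarrow> bool" where
  "small _ K g d M \<longleftrightarrow> (\<exists>N :: ('v, 'e, 'k, 'n) rep.
     contraction_rep K g N \<and> fin_gen_deg_le K g d N \<and> subquotient K g M N)"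

definition filtration ::
  "('k, 'r) ring_scheme \<Rightarrow> nat \<Rightarrow> ('v, 'e, 'k, 'm) rep \<Rightarrow> nat \<Rightarrow>
   (nat \<Rightarrow> ('v, 'e) pre_digraph \<Rightarrow> 'm set) \<Rightarrow> bool" where
  "filtration K g M m F \<longleftrightarrow>
     (\<forall>i\<le>m. subrep K g M (F i)) \<and>
     (\<forall>G. genus_graph g G \<longrightarrow>
        F 0 G = {\<zero>\<^bsub>ob M G\<^esub>} \<and> F m G = carrier (ob M G) \<and> (\<forall>i<m. F i G \<subseteq> F (Suc i) G))"

definition assoc_graded ::
  "('v, 'e, 'k, 'm) rep \<Rightarrow> nat \<Rightarrow> (nat \<Rightarrow> ('v, 'e) pre_digraph \<Rightarrow> 'm set) \<Rightarrow>
   ('v, 'e, 'k, nat \<Rightarrow> 'm set) rep" where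
  "assoc_graded M m F = dsum_rep {..<m} (\<lambda>i. quot_rep (restrict_rep M (F (Suc i))) (F i))"

definition smallish ::
  "'n itself \<Rightarrow> ('k, 'r) ring_scheme \<Rightarrow> nat \<Rightarrow> nat \<Rightarrow> ('v, 'e, 'k, 'm) rep \<Rightarrow> bool" where
  "smallish ty K g d M \<longleftrightarrow>
     (\<exists>m F. filtration K g M m F \<and> small ty K g d (assoc_graded M m F))"

end

theory Submission
  imports Defs
begin

text \<open>
  A contraction from \<open>G\<close> to \<open>H\<close> is determined by the signed arcs of \<open>G\<close> lying over the arcs of
  \<open>H\<close>, up to a self-map of the vertices of \<open>H\<close>. Hence there are at most \<open>c |G|^|H|\<close> of them, with
  \<open>c\<close> depending only on \<open>H\<close>, and this bounds the dimension of a finitely generated module.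
  To pass to modules that are smallish, no dimension of a quotient or direct sum is computed:
  a submodule \<open>W\<close> of \<open>M(G)\<close> induces a submodule of the associated graded module, whose preimage is
  a submodule of the finitely generated module at \<open>G\<close>. This assignment is strictly monotone by the
  modular law, and a strictly monotone map between lattices of subspaces bounds the dimension.
\<close>

section \<open>Cosets of submodules\<close>

text \<open>Scaling by minus one supplies the negatives. This makes the calculus of additive cosets
  available for submodules.\<close>

lemma (in module) submodule_abelian_subgroup:
  assumes "submodule R W M"
  shows "abelian_subgroup W M"
proof (rule abelian_subgroupI3)
  interpret W: submodule R W M by fact
  show "additive_subgroup W M"
  proof (unfold_locales)
    show "W \<subseteq> carrier (add_monoid M)" using W.subset by simp
    show "inv\<^bsub>add_monoid M\<^esub> x \<in> W" if "x \<in> W" for x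
    proof -
      have "\<ominus>\<^bsub>M\<^esub> x = (\<ominus>\<^bsub>R\<^esub> \<one>\<^bsub>R\<^esub>) \<odot>\<^bsub>M\<^esub> x"
        using that W.subset by (metis smult_minus_1 subsetD)
      then show ?thesis using that by (simp add: a_inv_def)
    qed
  qed auto
  show "abelian_group M" by unfold_locales
qed

lemma (in module) submodule_coset_eq_iff:
  assumes "submodule R W M" "x \<in> carrier M" "y \<in> carrier M"
  shows "W +>\<^bsub>M\<^esub> x = W +>\<^bsub>M\<^esub> y \<longleftrightarrow> (\<exists>w\<in>W. x = w \<oplus>\<^bsub>M\<^esub> y)"
proof -
  interpret abelian_subgroup W M using assms(1) by (rule submodule_abelian_subgroup)
  have "W +>\<^bsub>M\<^esub> x = W +>\<^bsub>M\<^esub> y \<longleftrightarrow> x \<in> W +>\<^bsub>M\<^esub> y"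
    using assms a_rcos_self a_repr_independence' by metis
  then show ?thesis by (auto simp: a_r_coset_def')
qed

lemma (in module) submodule_coset_add:
  assumes "submodule R W M" "x \<in> carrier M" "y \<in> carrier M"
  shows "(W +>\<^bsub>M\<^esub> x) <+>\<^bsub>M\<^esub> (W +>\<^bsub>M\<^esub> y) = W +>\<^bsub>M\<^esub> (x \<oplus>\<^bsub>M\<^esub> y)"
proof -
  interpret abelian_subgroup W M using assms(1) by (rule submodule_abelian_subgroup)
  show ?thesis using assms by (simp add: a_rcos_sum)
qed

text \<open>\<open>quot_module\<close> scales a coset by a union over all its representatives. These
  differ by elements of \<open>W\<close>, and so do their multiples, so all members of the union
  coincide.\<close>

lemma (in module) submodule_coset_smult:
  assumes W: "submodule R W M" and x: "x \<in> carrier M" and r: "r \<in> carrier R"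
  shows "(\<Union>z\<in>W +>\<^bsub>M\<^esub> x. W +>\<^bsub>M\<^esub> (r \<odot>\<^bsub>M\<^esub> z)) = W +>\<^bsub>M\<^esub> (r \<odot>\<^bsub>M\<^esub> x)"
proof -
  interpret abelian_subgroup W M using W by (rule submodule_abelian_subgroup)
  interpret W: submodule R W M by fact
  have "W +>\<^bsub>M\<^esub> (r \<odot>\<^bsub>M\<^esub> z) = W +>\<^bsub>M\<^esub> (r \<odot>\<^bsub>M\<^esub> x)" if "z \<in> W +>\<^bsub>M\<^esub> x" for z
  proof -
    obtain w where w: "w \<in> W" "z = w \<oplus>\<^bsub>M\<^esub> x" using \<open>z \<in> _\<close> by (auto simp: a_r_coset_def')
    then have "w \<in> carrier M" using W.subset by auto
    then have "r \<odot>\<^bsub>M\<^esub> z = (r \<odot>\<^bsub>M\<^esub> w) \<oplus>\<^bsub>M\<^esub> (r \<odot>\<^bsub>M\<^esub> x)" "z \<in> carrier M"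
      using x r w by (auto simp: smult_r_distr)
    moreover have "r \<odot>\<^bsub>M\<^esub> w \<in> W" using w r by auto
    ultimately show ?thesis using submodule_coset_eq_iff[OF W] x r by auto
  qed
  moreover have "x \<in> W +>\<^bsub>M\<^esub> x" using x by (rule a_rcos_self)
  ultimately show ?thesis by blast
qed

section \<open>Dimension and strictly monotone maps of submodules\<close>

text \<open>Each step of the greedy construction of a generating set of \<open>V\<close> also enlarges a linearly
  independent subset of \<open>N\<close>.\<close>

lemma dim_le_card_if_strict_mono_submodules:
  assumes "vectorspace K V" "vectorspace K N"
    and A: "finite A" "A \<subseteq> carrier N" "module.span K N A = carrier N"
    and sub: "\<And>W. submodule K W V \<Longrightarrow> submodule K (\<Phi> W) N"
    and strict: "\<And>W W'. submodule K W V \<Longrightarrow> submodule K W' V \<Longrightarrow> W \<subset> W' \<Longrightarrow> \<Phi> W \<subset> \<Phi> W'"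
  shows "vectorspace.fin_dim K V \<and> vectorspace.dim K V \<le> card A"
proof -
  interpret V: vectorspace K V by fact
  interpret N: vectorspace K N by fact
  \<comment> \<open>\<open>B\<close> holds the vectors chosen so far in \<open>V\<close>, and
    \<open>C\<close> is an independent set in \<open>N\<close> that witnesses their number.
    Independence in \<open>N\<close> is what caps the size.\<close>
  define P where "P B C \<longleftrightarrow> finite B \<and> B \<subseteq> carrier V \<and> finite C \<and> C \<subseteq> \<Phi> (V.span B) \<and>
    N.lin_indpt C \<and> card B \<le> card C" for B C
  have fd: "N.fin_dim" using A by (auto simp: N.fin_dim_def)
  have spanB: "submodule K (V.span B) V" if "B \<subseteq> carrier V" for B
    using that by (rule V.span_is_submodule)
  have bound: "card C \<le> card A" if "P B C" for B C
  proof -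
    have "submodule K (\<Phi> (V.span B)) N" using that sub spanB by (auto simp: P_def)
    then have "C \<subseteq> carrier N" using that by (auto simp: P_def submodule_def)
    then have "card C \<le> N.dim" using that fd N.li_le_dim by (auto simp: P_def)
    also have "\<dots> \<le> card A" using A N.gen_ge_dim by auto
    finally show ?thesis .
  qed
  define Q where "Q n \<longleftrightarrow> (\<exists>B C. P B C \<and> card C = n)" for n
  have "P {} {}" by (auto simp: P_def N.lin_dep_def)
  then have "\<exists>n. Q n" by (auto simp: Q_def)
  have le: "n \<le> card A" if "Q n" for n using that bound by (auto simp: Q_def)
  \<comment> \<open>\<open>V\<close> is not yet known to be finite-dimensional, so the greedy
    process is replaced by a pair whose \<open>C\<close> is as large as possible.\<close>
  define n where "n = Greatest Q"
  have n: "Q n" unfolding n_def using \<open>\<exists>n. Q n\<close> le by (rule GreatestI_ex_nat)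
  have max: "k \<le> n" if "Q k" for k
    unfolding n_def using that le by (rule Greatest_le_nat)
  obtain B C where BC: "P B C" "card C = n" using n by (auto simp: Q_def)
  have B: "finite B" "B \<subseteq> carrier V" and C: "finite C" "C \<subseteq> \<Phi> (V.span B)" "N.lin_indpt C"
    and cardBC: "card B \<le> card C"
    using BC by (auto simp: P_def)
  \<comment> \<open>A vector \<open>x\<close> outside the span would enlarge \<Phi> strictly. Any
    new \<open>y\<close> lies outside the span of \<open>C\<close>, so adding \<open>x\<close> to
    \<open>B\<close> and \<open>y\<close> to \<open>C\<close> would contradict maximality.\<close>
  have "V.span B = carrier V"
  proof (rule ccontr)
    assume "V.span B \<noteq> carrier V"
    then obtain x where x: "x \<in> carrier V" "x \<notin> V.span B"
      using V.span_is_subset2[OF B(2)] by auto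
    have xB: "insert x B \<subseteq> carrier V" using x B by auto
    have "V.span B \<subseteq> V.span (insert x B)" by (rule V.span_is_monotone) auto
    moreover have "x \<in> V.span (insert x B)" using V.in_own_span[OF xB] by auto
    ultimately have "V.span B \<subset> V.span (insert x B)" using x by auto
    then have ss: "\<Phi> (V.span B) \<subset> \<Phi> (V.span (insert x B))"
      using strict spanB B xB by auto
    then obtain y where y: "y \<in> \<Phi> (V.span (insert x B))" "y \<notin> \<Phi> (V.span B)" by auto
    have subB: "submodule K (\<Phi> (V.span B)) N" using sub spanB B by auto
    then have Cc: "C \<subseteq> carrier N" using C by (auto simp: submodule_def)
    have "submodule K (\<Phi> (V.span (insert x B))) N" using sub spanB xB by auto
    then have yc: "y \<in> carrier N" using y by (auto simp: submodule_def)
    have "N.span C \<subseteq> \<Phi> (V.span B)" using C subB by (intro N.span_is_subset) auto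
    then have "y \<notin> N.span C" "y \<notin> C" using y C by auto
    then have "N.lin_indpt (C \<union> {y})"
      using N.lin_dep_iff_in_span[OF Cc C(3) yc] by auto
    then have "P (insert x B) (insert y C)"
      using B xB C y ss cardBC \<open>y \<notin> C\<close> by (auto simp: P_def card_insert_if)
    then have "card (insert y C) \<le> n" using max unfolding Q_def by blast
    then show False using BC C \<open>y \<notin> C\<close> by auto
  qed
  then have "V.fin_dim" "V.dim \<le> card B"
    using B V.gen_ge_dim by (auto simp: V.fin_dim_def)
  then show ?thesis using cardBC bound[OF BC(1)] by auto
qed

section \<open>Filtered modules\<close>

text \<open>This is the associated graded of \<open>W\<close> for the induced filtration
  \<open>W \<inter> F i\<close>, realised inside that of \<open>V\<close>.\<close>

definition gr_submodule ::
  "('k, 'm) module \<Rightarrow> nat \<Rightarrow> (nat \<Rightarrow> 'm set) \<Rightarrow> 'm set \<Rightarrow> (nat \<Rightarrow> 'm set) set" where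
  "gr_submodule V m F W =
     (\<Pi>\<^sub>E i\<in>{..<m}. (\<lambda>w. F i +>\<^bsub>V\<^esub> w) ` (W \<inter> F (Suc i)))"

text \<open>The value of \<open>assoc_graded\<close> at a single graph.\<close>

abbreviation gr_module :: "('k, 'm) module \<Rightarrow> nat \<Rightarrow> (nat \<Rightarrow> 'm set) \<Rightarrow> ('k, nat \<Rightarrow> 'm set) module" where
  "gr_module V m F \<equiv> dsum_module {..<m} (\<lambda>i. quot_module (V\<lparr>carrier := F (Suc i)\<rparr>) (F i))"

lemma a_r_coset_carrier_update [simp]: "W +>\<^bsub>V\<lparr>carrier := S\<rparr>\<^esub> x = W +>\<^bsub>V\<^esub> x"
  by (simp add: a_r_coset_def')

lemma set_add_carrier_update [simp]: "X <+>\<^bsub>V\<lparr>carrier := S\<rparr>\<^esub> Y = X <+>\<^bsub>V\<^esub> Y"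
  by (simp add: set_add_def')

lemma carrier_quot_module_restrict:
  "carrier (quot_module (V\<lparr>carrier := S\<rparr>) T) = (\<lambda>x. T +>\<^bsub>V\<^esub> x) ` S"
  by (auto simp: quot_module_def A_RCOSETS_def')

locale filtered_module = module R V for R :: "('k, 'r) ring_scheme" and V :: "('k, 'm) module" +
  fixes m :: nat and F :: "nat \<Rightarrow> 'm set"
  assumes submod: "i \<le> m \<Longrightarrow> submodule R (F i) V"
    and bot: "F 0 = {\<zero>\<^bsub>V\<^esub>}"
    and top: "F m = carrier V"
begin

lemma gr_submodule_subset:
  "gr_submodule V m F W \<subseteq> carrier (gr_module V m F)"
  unfolding gr_submodule_def dsum_module_def 
  by (simp add: carrier_quot_module_restrict) (intro PiE_mono, auto)

lemma gr_submodule_mono: "W \<subseteq> W' \<Longrightarrow> gr_submodule V m F W \<subseteq> gr_submodule V m F W'"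
  unfolding gr_submodule_def by (intro PiE_mono) auto

text \<open>In each degree representatives can be taken in \<open>W \<inter> F (Suc i)\<close>,
  which is closed under addition. With the next two lemmas this stands in for being a submodule, as
  \<open>gr_module\<close> is not itself shown to be a module.\<close>

lemma gr_submodule_add:
  assumes W: "submodule R W V" and u: "u \<in> gr_submodule V m F W" and v: "v \<in> gr_submodule V m F W"
  shows "u \<oplus>\<^bsub>gr_module V m F\<^esub> v \<in> gr_submodule V m F W"
proof -
  have "u i <+>\<^bsub>V\<^esub> v i \<in> (\<lambda>w. F i +>\<^bsub>V\<^esub> w) ` (W \<inter> F (Suc i))" if i: "i < m" for i
  proof -
    interpret W: submodule R W V by fact
    interpret S: submodule R "F (Suc i)" V using i by (intro submod) auto
    obtain x where x: "x \<in> W" "x \<in> F (Suc i)" "u i = F i +>\<^bsub>V\<^esub> x"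
      using u i by (auto simp: gr_submodule_def PiE_iff)
    obtain y where y: "y \<in> W" "y \<in> F (Suc i)" "v i = F i +>\<^bsub>V\<^esub> y"
      using v i by (auto simp: gr_submodule_def PiE_iff)
    have "u i <+>\<^bsub>V\<^esub> v i = F i +>\<^bsub>V\<^esub> (x \<oplus>\<^bsub>V\<^esub> y)"
      using x y i W.subset submod by (subst x, subst y, intro submodule_coset_add) auto
    then show ?thesis using x y by auto
  qed
  then show ?thesis by (auto simp: gr_submodule_def dsum_module_def quot_module_def)
qed

lemma gr_submodule_smult:
  assumes W: "submodule R W V" and u: "u \<in> gr_submodule V m F W" and r: "r \<in> carrier R"
  shows "r \<odot>\<^bsub>gr_module V m F\<^esub> u \<in> gr_submodule V m F W"
proof -
  have "(\<Union>z\<in>u i. F i +>\<^bsub>V\<^esub> (r \<odot>\<^bsub>V\<^esub> z)) \<in> (\<lambda>w. F i +>\<^bsub>V\<^esub> w) ` (W \<inter> F (Suc i))"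
    if i: "i < m" for i
  proof -
    interpret W: submodule R W V by fact
    interpret S: submodule R "F (Suc i)" V using i by (intro submod) auto
    obtain x where x: "x \<in> W" "x \<in> F (Suc i)" "u i = F i +>\<^bsub>V\<^esub> x"
      using u i by (auto simp: gr_submodule_def PiE_iff)
    have "(\<Union>z\<in>u i. F i +>\<^bsub>V\<^esub> (r \<odot>\<^bsub>V\<^esub> z)) = F i +>\<^bsub>V\<^esub> (r \<odot>\<^bsub>V\<^esub> x)"
      using x i r W.subset submod by (subst x, intro submodule_coset_smult) auto
    then show ?thesis using x r by auto
  qed
  then show ?thesis by (auto simp: gr_submodule_def dsum_module_def quot_module_def)
qed

text \<open>The coset of zero is available in every degree.\<close>

lemma gr_submodule_nonempty:
  assumes W: "submodule R W V"
  shows "gr_submodule V m F W \<noteq> {}"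
proof -
  have "\<zero>\<^bsub>V\<^esub> \<in> W \<inter> F (Suc i)" if "i < m" for i
    using W submod[of "Suc i"] that by (auto simp: submodule_def)
  then show ?thesis unfolding gr_submodule_def PiE_eq_empty_iff by blast
qed

text \<open>By the modular law a submodule is determined, within a larger one, by its graded pieces.\<close>

lemma gr_submodule_strict:
  assumes W: "submodule R W V" and W': "submodule R W' V" and le: "W \<subseteq> W'"
    and eq: "gr_submodule V m F W' \<subseteq> gr_submodule V m F W"
  shows "W' \<subseteq> W"
proof -
  interpret W: submodule R W V by fact
  interpret W': submodule R W' V by fact
  \<comment> \<open>An inclusion of products yields one of factors: take any element of the product,
    put the coset of \<open>x\<close> in coordinate \<open>i\<close>, and read that coordinate
    back.\<close>
  have step: "\<exists>w\<in>W \<inter> F (Suc i). F i +>\<^bsub>V\<^esub> x = F i +>\<^bsub>V\<^esub> w" if i: "i < m" and x: "x \<in> W' \<inter> F (Suc i)" for i x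
  proof -
    have "gr_submodule V m F W' \<noteq> {}" using W' by (rule gr_submodule_nonempty)
    then obtain u where u: "u \<in> gr_submodule V m F W'" by auto
    define u' where "u' = u(i := F i +>\<^bsub>V\<^esub> x)"
    have "u' \<in> gr_submodule V m F W'"
      using u x i by (auto simp: u'_def gr_submodule_def PiE_iff extensional_def)
    then have "u' \<in> gr_submodule V m F W" using eq by auto
    then have "u' i \<in> (\<lambda>w. F i +>\<^bsub>V\<^esub> w) ` (W \<inter> F (Suc i))" using i by (auto simp: gr_submodule_def PiE_iff)
    then show ?thesis by (auto simp: u'_def)
  qed
  \<comment> \<open>Induction up the filtration, from the zero submodule at \<open>0\<close> to all
    of \<open>V\<close> at \<open>m\<close>.\<close>
  have "W' \<inter> F i \<subseteq> W" if "i \<le> m" for i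
    using that
  proof (induction i)
    case 0
    then show ?case using bot by auto
  next
    case (Suc i)
    show ?case
    proof
      fix x assume x: "x \<in> W' \<inter> F (Suc i)"
      then obtain w where w: "w \<in> W" "w \<in> F (Suc i)" "F i +>\<^bsub>V\<^esub> x = F i +>\<^bsub>V\<^esub> w"
        using step[of i x] Suc by auto
      have xc: "x \<in> carrier V" and wc: "w \<in> carrier V" using x w W.subset W'.subset by auto
      have Fi: "submodule R (F i) V" using Suc submod by auto
      then obtain f where f: "f \<in> F i" "x = f \<oplus>\<^bsub>V\<^esub> w"
        using w submodule_coset_eq_iff[OF Fi xc wc] by auto
      have fc: "f \<in> carrier V" using f Fi by (auto simp: submodule_def)
      \<comment> \<open>Since \<open>W\<close> lies in \<open>W'\<close>, the difference stays in
        \<open>W'\<close>; it also lies in \<open>F i\<close>, so the induction hypothesis puts it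
        in \<open>W\<close>.\<close>
      have "f = x \<ominus>\<^bsub>V\<^esub> w" using f fc wc by (simp add: M.minus_eq M.add.m_assoc M.r_neg)
      also have "\<dots> \<in> W'"
      proof -
        interpret abelian_subgroup W' V using W' by (rule submodule_abelian_subgroup)
        show ?thesis using x w le by (auto simp: M.minus_eq)
      qed
      finally have "f \<in> W" using f Suc by auto
      then show "x \<in> W" using f w by auto
    qed
  qed
  from this[of m] show ?thesis using top W'.subset by auto
qed

end

text \<open>\<Phi> pulls the \<eta>-image of the graded pieces of \<open>W\<close> back along the
  projection from \<open>S\<close> to the quotient by \<open>T\<close>. It meets the requirements of
  \<open>dim_le_card_if_strict_mono_submodules\<close>, and \<open>A\<close> spans
  \<open>N\<close>.\<close>

lemma (in filtered_module) dim_le_of_gr_subquotient: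
  assumes "field R" and N: "vectorspace R N"
    and A: "finite A" "A \<subseteq> carrier N" "module.span R N A = carrier N"
    and S: "submodule R S N" and T: "submodule R T N"
    and \<eta>: "\<eta> \<in> module_hom R (gr_module V m F) (quot_module (N\<lparr>carrier := S\<rparr>) T)"
    and bij: "bij_betw \<eta> (carrier (gr_module V m F)) (carrier (quot_module (N\<lparr>carrier := S\<rparr>) T))"
  shows "vectorspace.fin_dim R V \<and> vectorspace.dim R V \<le> card A"
proof -
  interpret N: vectorspace R N by fact
  interpret S: submodule R S N by fact
  define \<Phi> where "\<Phi> W = {x \<in> S. T +>\<^bsub>N\<^esub> x \<in> \<eta> ` gr_submodule V m F W}" for W
  have V: "vectorspace R V" using \<open>field R\<close> module_axioms by (simp add: vectorspace_def)
  have sub: "submodule R (\<Phi> W) N" if W: "submodule R W V" for W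
  proof (unfold_locales)
    show "\<Phi> W \<subseteq> carrier N" using S.subset by (auto simp: \<Phi>_def)
  next
    fix x y assume "x \<in> \<Phi> W" "y \<in> \<Phi> W"
    then obtain u v where x: "x \<in> S" "T +>\<^bsub>N\<^esub> x = \<eta> u" and u: "u \<in> gr_submodule V m F W"
      and y: "y \<in> S" "T +>\<^bsub>N\<^esub> y = \<eta> v" and v: "v \<in> gr_submodule V m F W"
      by (auto simp: \<Phi>_def)
    have uv: "u \<in> carrier (gr_module V m F)" "v \<in> carrier (gr_module V m F)"
      using gr_submodule_subset u v by auto
    have "T +>\<^bsub>N\<^esub> (x \<oplus>\<^bsub>N\<^esub> y) = (T +>\<^bsub>N\<^esub> x) <+>\<^bsub>N\<^esub> (T +>\<^bsub>N\<^esub> y)"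
      using x y S.subset T by (intro N.submodule_coset_add[symmetric]) auto
    also have "\<dots> = \<eta> u <+>\<^bsub>N\<^esub> \<eta> v" using x y by simp
    also have "\<dots> = \<eta> (u \<oplus>\<^bsub>gr_module V m F\<^esub> v)"
      using module_hom_add[OF \<eta> uv] by (simp add: quot_module_def)
    finally have "T +>\<^bsub>N\<^esub> (x \<oplus>\<^bsub>N\<^esub> y) \<in> \<eta> ` gr_submodule V m F W"
      using gr_submodule_add[OF W u v] by auto
    then show "x \<oplus>\<^bsub>N\<^esub> y \<in> \<Phi> W" using x y by (auto simp: \<Phi>_def)
  next
    fix r x assume r: "r \<in> carrier R" and "x \<in> \<Phi> W"
    then obtain u where x: "x \<in> S" "T +>\<^bsub>N\<^esub> x = \<eta> u" and u: "u \<in> gr_submodule V m F W"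
      by (auto simp: \<Phi>_def)
    have uc: "u \<in> carrier (gr_module V m F)" using gr_submodule_subset u by auto
    have "T +>\<^bsub>N\<^esub> (r \<odot>\<^bsub>N\<^esub> x) = (\<Union>z\<in>T +>\<^bsub>N\<^esub> x. T +>\<^bsub>N\<^esub> (r \<odot>\<^bsub>N\<^esub> z))"
      using x r S.subset T by (intro N.submodule_coset_smult[symmetric]) auto
    also have "\<dots> = \<eta> (r \<odot>\<^bsub>gr_module V m F\<^esub> u)"
      using module_hom_smult[OF \<eta> r uc] x by (simp add: quot_module_def)
    finally have "T +>\<^bsub>N\<^esub> (r \<odot>\<^bsub>N\<^esub> x) \<in> \<eta> ` gr_submodule V m F W"
      using gr_submodule_smult[OF W u r] by auto
    then show "r \<odot>\<^bsub>N\<^esub> x \<in> \<Phi> W" using x r by (auto simp: \<Phi>_def)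
  next
    obtain u where u: "u \<in> gr_submodule V m F W" using gr_submodule_nonempty[OF W] by auto
    have uc: "u \<in> carrier (gr_module V m F)" using gr_submodule_subset u by auto
    then have "\<eta> u \<in> carrier (quot_module (N\<lparr>carrier := S\<rparr>) T)"
      using \<eta> module_hom_closed by blast
    then obtain x where x: "x \<in> S" "\<eta> u = T +>\<^bsub>N\<^esub> x"
      by (auto simp: carrier_quot_module_restrict)
    \<comment> \<open>Zero is reached by scaling a representative by the zero scalar, so
      compatibility of \<eta> with scaling suffices and nothing about the zero of
      \<open>gr_module\<close> is used.\<close>
    have "T +>\<^bsub>N\<^esub> (\<zero>\<^bsub>R\<^esub> \<odot>\<^bsub>N\<^esub> x) = (\<Union>z\<in>T +>\<^bsub>N\<^esub> x. T +>\<^bsub>N\<^esub> (\<zero>\<^bsub>R\<^esub> \<odot>\<^bsub>N\<^esub> z))"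
      using x S.subset T by (intro N.submodule_coset_smult[symmetric]) auto
    also have "\<dots> = \<eta> (\<zero>\<^bsub>R\<^esub> \<odot>\<^bsub>gr_module V m F\<^esub> u)"
      using module_hom_smult[OF \<eta> _ uc] x by (simp add: quot_module_def)
    finally have "T +>\<^bsub>N\<^esub> (\<zero>\<^bsub>R\<^esub> \<odot>\<^bsub>N\<^esub> x) \<in> \<eta> ` gr_submodule V m F W"
      using gr_submodule_smult[OF W u] by auto
    moreover have "\<zero>\<^bsub>R\<^esub> \<odot>\<^bsub>N\<^esub> x = \<zero>\<^bsub>N\<^esub>" using x S.subset by auto
    ultimately show "\<zero>\<^bsub>N\<^esub> \<in> \<Phi> W" by (simp add: \<Phi>_def)
  qed
  have strict: "\<Phi> W \<subset> \<Phi> W'" if W: "submodule R W V" "submodule R W' V" "W \<subset> W'" for W W'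
  proof
    show "\<Phi> W \<subseteq> \<Phi> W'" using gr_submodule_mono[of W W'] W by (auto simp: \<Phi>_def)
    show "\<Phi> W \<noteq> \<Phi> W'"
    proof
      assume eq: "\<Phi> W = \<Phi> W'"
      \<comment> \<open>Every coset in the target has a representative in \<open>S\<close>, so equal
        preimages force equal images under \<eta>, and injectivity recovers the graded
        pieces.\<close>
      have "gr_submodule V m F W' \<subseteq> gr_submodule V m F W"
      proof
        fix u assume u: "u \<in> gr_submodule V m F W'"
        then have uc: "u \<in> carrier (gr_module V m F)" using gr_submodule_subset by auto
        then have "\<eta> u \<in> carrier (quot_module (N\<lparr>carrier := S\<rparr>) T)"
          using \<eta> module_hom_closed by blast
        then obtain x where x: "x \<in> S" "\<eta> u = T +>\<^bsub>N\<^esub> x"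
          by (auto simp: carrier_quot_module_restrict)
        then have "x \<in> \<Phi> W" using u eq by (auto simp: \<Phi>_def)
        then obtain u' where u': "u' \<in> gr_submodule V m F W" "\<eta> u' = \<eta> u"
          using x by (auto simp: \<Phi>_def)
        moreover have "u' \<in> carrier (gr_module V m F)" using u' gr_submodule_subset by auto
        ultimately show "u \<in> gr_submodule V m F W"
          using uc inj_onD[OF bij_betw_imp_inj_on[OF bij], of u' u] by simp
      qed
      then have "W' \<subseteq> W" using gr_submodule_strict W by blast
      then show False using W by auto
    qed
  qed
  show ?thesis
    using V N A sub strict by (rule dim_le_card_if_strict_mono_submodules)
qed

section \<open>Counting contractions\<close>

text \<open>The boolean keeps the orientation, which tells a loop from its flip. For a contraction
  and an arc \<open>b\<close> of the target the description is unique.\<close>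

definition edge_lift ::
  "('v, 'e) pre_digraph \<Rightarrow> ('v, 'e) graph_map \<Rightarrow> 'e \<Rightarrow> 'e \<times> bool" where
  "edge_lift G \<phi> b = (THE p. fst p \<in> arcs G \<and> emap \<phi> (fst p) = Inr (b, snd p))"

text \<open>Contractions with the same signed lifts differ only in this way. The result need not be
  a morphism: it only has to reach every contraction in the count.\<close>

definition relabel ::
  "('v, 'e) pre_digraph \<Rightarrow> ('v \<Rightarrow> 'v) \<Rightarrow> ('v, 'e) graph_map \<Rightarrow> ('v, 'e) graph_map" where
  "relabel G \<pi> \<phi> =
     \<lparr>vmap = compose (verts G) \<pi> (vmap \<phi>), emap = (\<lambda>a\<in>arcs G. map_sum \<pi> id (emap \<phi> a))\<rparr>"

lemma edge_lift_eq_iff: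
  assumes "contraction G H \<phi>" "b \<in> arcs H"
  shows "edge_lift G \<phi> b = (a, t) \<longleftrightarrow> a \<in> arcs G \<and> emap \<phi> a = Inr (b, t)"
proof -
  have ex1: "\<exists>!a. a \<in> arcs G \<and> (\<exists>s. emap \<phi> a = Inr (b, s))"
    using assms by (auto simp: contraction_def)
  then obtain a0 s0 where a0: "a0 \<in> arcs G" "emap \<phi> a0 = Inr (b, s0)" by auto
  have uniq: "a = a0 \<and> s = s0" if "a \<in> arcs G" "emap \<phi> a = Inr (b, s)" for a s
  proof -
    have "a = a0" using ex1 a0 that by blast
    then show ?thesis using a0 that by simp
  qed
  have "edge_lift G \<phi> b = (a0, s0)"
    unfolding edge_lift_def
  proof (rule the_equality)
    show "fst (a0, s0) \<in> arcs G \<and> emap \<phi> (fst (a0, s0)) = Inr (b, snd (a0, s0))"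
      using a0 by simp
    show "p = (a0, s0)" if "fst p \<in> arcs G \<and> emap \<phi> (fst p) = Inr (b, snd p)" for p
      using uniq[of "fst p" "snd p"] that by (simp add: prod_eq_iff)
  qed
  then show ?thesis using a0 uniq[of a t] by auto
qed

lemma contraction_target_arc:
  assumes "contraction G H \<phi>" "a \<in> arcs G" "emap \<phi> a = Inr (b, t)"
  shows "b \<in> arcs H"
proof -
  have "emap \<phi> a \<in> verts H <+> arcs H \<times> UNIV"
    using assms by (auto simp: contraction_def graph_morphism_def PiE_iff)
  then show ?thesis using assms by auto
qed

text \<open>The fibers of \<open>\<phi>\<close> are connected by arcs that \<open>\<psi>\<close> collapses as well, so \<open>\<psi>\<close> is constant on
  them.\<close>

lemma vmap_constant_on_fibers:
  assumes \<phi>: "contraction G H \<phi>" and \<psi>: "contraction G H \<psi>"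
    and same: "\<And>a b t. a \<in> arcs G \<Longrightarrow> emap \<psi> a = Inr (b, t) \<longleftrightarrow> emap \<phi> a = Inr (b, t)"
    and v: "v \<in> verts G" "v' \<in> verts G" "vmap \<phi> v = vmap \<phi> v'"
  shows "vmap \<psi> v = vmap \<psi> v'"
proof -
  let ?w = "vmap \<phi> v"
  \<comment> \<open>Connectedness is strong connectedness of the symmetric closure, so walks in
    \<open>?X\<close> may traverse arcs of the fiber in either direction.\<close>
  let ?X = "mk_symmetric (vertex_fiber G \<phi> ?w)"
  have "?w \<in> verts H" using \<phi> v by (auto simp: contraction_def graph_morphism_def PiE_iff)
  then have "Digraph_Component.connected (vertex_fiber G \<phi> ?w)"
    using \<phi> by (auto simp: contraction_def genus_graph_def)
  then have "v \<rightarrow>\<^sup>*\<^bsub>with_proj ?X\<^esub> v'"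
    using v by (auto simp: connected_def strongly_connected_def mk_symmetric_def vertex_fiber_def)
  then have "(v, v') \<in> rtrancl_on (verts (with_proj ?X)) (arcs_ends (with_proj ?X))"
    by (simp add: reachable_def)
  then show ?thesis
  proof (induction rule: rtrancl_on_induct)
    case (step y z)
    then obtain a where a: "a \<in> arcs G" "emap \<phi> a = Inl ?w"
      "(y, z) = (tail G a, head G a) \<or> (y, z) = (head G a, tail G a)"
      by (auto simp: arcs_ends_def arc_to_ends_def mk_symmetric_def vertex_fiber_def)
    \<comment> \<open>If \<psi> sent \<open>a\<close> to an arc, then by \<open>same\<close> so
      would \<phi>, but \<open>a\<close> lies in a fiber of \<phi>.\<close>
    obtain w' where "emap \<psi> a = Inl w'"
      using a same[of a] by (cases "emap \<psi> a") auto
    then have "vmap \<psi> (tail G a) = vmap \<psi> (head G a)"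
      using \<psi> a unfolding contraction_def graph_morphism_def by fastforce
    then show ?case using step a by auto
  qed simp
qed

text \<open>\<pi> evaluates \<psi> at a chosen point of each fiber of \<phi>; constancy on fibers
  makes the choice immaterial. The image of a collapsed arc is then read off from its tail.\<close>

lemma contraction_relabel:
  assumes "wf_digraph G" and \<phi>: "contraction G H \<phi>" and \<psi>: "contraction G H \<psi>"
    and same: "\<And>a b t. a \<in> arcs G \<Longrightarrow> emap \<psi> a = Inr (b, t) \<longleftrightarrow> emap \<phi> a = Inr (b, t)"
  shows "\<exists>\<pi>\<in>verts H \<rightarrow>\<^sub>E verts H. \<psi> = relabel G \<pi> \<phi>"
proof -
  interpret wf_digraph G by fact
  define s where "s w = (SOME v. v \<in> verts G \<and> vmap \<phi> v = w)" for w
  define \<pi> where "\<pi> = (\<lambda>w\<in>verts H. vmap \<psi> (s w))"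
  have morph: "graph_morphism G H \<phi>" "graph_morphism G H \<psi>"
    using \<phi> \<psi> by (auto simp: contraction_def)
  have s: "s w \<in> verts G \<and> vmap \<phi> (s w) = w" if "w \<in> verts H" for w
  proof -
    have "genus_graph 0 (vertex_fiber G \<phi> w)" using that \<phi> by (auto simp: contraction_def)
    then have "verts (vertex_fiber G \<phi> w) \<noteq> {}"
      by (auto simp: genus_graph_def connected_def strongly_connected_def mk_symmetric_def)
    then have "\<exists>v. v \<in> verts G \<and> vmap \<phi> v = w" by (auto simp: vertex_fiber_def)
    then show ?thesis unfolding s_def by (rule someI_ex)
  qed
  have \<pi>: "\<pi> \<in> verts H \<rightarrow>\<^sub>E verts H"
    using s morph(2) by (auto simp: \<pi>_def graph_morphism_def PiE_iff)
  have vmap_H: "vmap \<phi> v \<in> verts H" if "v \<in> verts G" for v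
    using morph(1) that by (auto simp: graph_morphism_def)
  have vmap: "vmap \<psi> v = \<pi> (vmap \<phi> v)" if "v \<in> verts G" for v
    unfolding \<pi>_def using vmap_H[OF that] s[OF vmap_H[OF that]] that
    by (simp, intro vmap_constant_on_fibers[OF \<phi> \<psi> same]) auto
  have "vmap \<psi> = compose (verts G) \<pi> (vmap \<phi>)"
  proof
    fix v
    show "vmap \<psi> v = compose (verts G) \<pi> (vmap \<phi>) v"
      using vmap morph(2)
      by (cases "v \<in> verts G")
         (auto simp: compose_def graph_morphism_def PiE_iff extensional_def)
  qed
  moreover have "emap \<psi> = (\<lambda>a\<in>arcs G. map_sum \<pi> id (emap \<phi> a))"
  proof
    fix a
    show "emap \<psi> a = (\<lambda>a\<in>arcs G. map_sum \<pi> id (emap \<phi> a)) a"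
    proof (cases "a \<in> arcs G")
      case False
      then show ?thesis using morph(2) by (auto simp: graph_morphism_def PiE_iff extensional_def)
    next
      case True
      show ?thesis
      proof (cases "emap \<phi> a")
        case (Inr p)
        then show ?thesis using same[OF True] True by (cases p) auto
      next
        case (Inl w)
        then obtain w' where w': "emap \<psi> a = Inl w'"
          using same[OF True] by (cases "emap \<psi> a") auto
        then have "w' = vmap \<psi> (tail G a)" "w = vmap \<phi> (tail G a)"
          using Inl True morph unfolding graph_morphism_def by fastforce+
        then show ?thesis using vmap True Inl w' by simp
      qed
    qed
  qed
  ultimately have "\<psi> = relabel G \<pi> \<phi>" by (simp add: relabel_def)
  with \<pi> show ?thesis by blast
qed

text \<open>One reference contraction is fixed for each family of signed lifts, and every
  contraction with these lifts is a relabelling of it. There are at most (2|G|)^|H| families, and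
  the self-maps of the vertices of \<open>H\<close> give the remaining factor.\<close>

lemma card_contractions_le:
  assumes G: "fin_digraph G" and H: "fin_digraph H"
  shows "finite {\<phi>. contraction G H \<phi>}"
    and "card {\<phi>. contraction G H \<phi>} \<le>
      card (verts H) ^ card (verts H) * 2 ^ card (arcs H) * card (arcs G) ^ card (arcs H)"
proof -
  interpret G: fin_digraph G by fact
  interpret H: fin_digraph H by fact
  define lift where "lift \<phi> = restrict (edge_lift G \<phi>) (arcs H)" for \<phi>
  \<comment> \<open>For an \<open>s\<close> that comes from no contraction the value is arbitrary.
    This is harmless, because the pairs only have to cover the contractions.\<close>
  define base where "base s = (SOME \<phi>. contraction G H \<phi> \<and> lift \<phi> = s)" for s
  let ?D = "(arcs H \<rightarrow>\<^sub>E arcs G \<times> (UNIV :: bool set)) \<times> (verts H \<rightarrow>\<^sub>E verts H)"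
  have fin: "finite ?D" by (intro finite_cartesian_product finite_PiE) auto
  have sub: "{\<phi>. contraction G H \<phi>} \<subseteq> (\<lambda>(s, \<pi>). relabel G \<pi> (base s)) ` ?D"
  proof
    fix \<psi> assume "\<psi> \<in> {\<phi>. contraction G H \<phi>}"
    then have \<psi>: "contraction G H \<psi>" by simp
    let ?\<phi> = "base (lift \<psi>)"
    have \<phi>: "contraction G H ?\<phi> \<and> lift ?\<phi> = lift \<psi>"
      unfolding base_def by (rule someI[of _ \<psi>]) (simp add: \<psi>)
    then have same_lift: "edge_lift G ?\<phi> b = edge_lift G \<psi> b" if "b \<in> arcs H" for b
      using that by (metis lift_def restrict_apply')
    have same: "emap \<psi> a = Inr (b, t) \<longleftrightarrow> emap ?\<phi> a = Inr (b, t)" if "a \<in> arcs G" for a b t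
    proof (cases "b \<in> arcs H")
      case True
      then show ?thesis using edge_lift_eq_iff[OF \<psi> True, of a t] same_lift
          edge_lift_eq_iff[OF conjunct1[OF \<phi>] True, of a t] that by simp
    next
      \<comment> \<open>Neither map hits a \<open>b\<close> outside the arcs of \<open>H\<close>, so
        both sides are false.\<close>
      case False
      then show ?thesis using contraction_target_arc[OF \<psi> that] contraction_target_arc[OF conjunct1[OF \<phi>] that] by metis
    qed
    obtain \<pi> where "\<pi> \<in> verts H \<rightarrow>\<^sub>E verts H" "\<psi> = relabel G \<pi> ?\<phi>"
      using contraction_relabel[OF G.wf_digraph_axioms conjunct1[OF \<phi>] \<psi> same] by blast
    moreover have "lift \<psi> \<in> arcs H \<rightarrow>\<^sub>E arcs G \<times> UNIV"
    proof -
      have "fst (edge_lift G \<psi> b) \<in> arcs G" if "b \<in> arcs H" for b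
        using edge_lift_eq_iff[OF \<psi> that] by (metis prod.collapse)
      then show ?thesis by (auto simp: lift_def mem_Times_iff)
    qed
    ultimately show "\<psi> \<in> (\<lambda>(s, \<pi>). relabel G \<pi> (base s)) ` ?D" by force
  qed
  then show "finite {\<phi>. contraction G H \<phi>}" using fin finite_subset by blast
  have "card {\<phi>. contraction G H \<phi>} \<le> card ?D"
    using sub fin by (rule surj_card_le[rotated])
  also have "\<dots> = card (verts H) ^ card (verts H) * 2 ^ card (arcs H) * card (arcs G) ^ card (arcs H)"
    by (simp add: card_cartesian_product card_funcsetE power_mult_distrib)
  finally show "card {\<phi>. contraction G H \<phi>} \<le>
      card (verts H) ^ card (verts H) * 2 ^ card (arcs H) * card (arcs G) ^ card (arcs H)" .
qed

section \<open>The dimension bound\<close>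

lemma card_indexed_image_le:
  fixes r :: nat
  assumes fin: "\<And>i. i < r \<Longrightarrow> finite (X i)"
  shows "finite {f i x |i x. i < r \<and> x \<in> X i}"
    and "card {f i x |i x. i < r \<and> x \<in> X i} \<le> (\<Sum>i<r. card (X i))"
proof -
  have eq: "{f i x |i x. i < r \<and> x \<in> X i} = (\<Union>i<r. f i ` X i)" by auto
  show "finite {f i x |i x. i < r \<and> x \<in> X i}" unfolding eq using fin by auto
  have "card (\<Union>i<r. f i ` X i) \<le> (\<Sum>i<r. card (f i ` X i))" by (rule card_UN_le) simp
  also have "\<dots> \<le> (\<Sum>i<r. card (X i))" using fin by (intro sum_mono card_image_le) auto
  finally show "card {f i x |i x. i < r \<and> x \<in> X i} \<le> (\<Sum>i<r. card (X i))" unfolding eq .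
qed

text \<open>\<open>dim\<close> is informative only for spaces with a finite spanning set, so
  \<open>fin_dim\<close> is asserted along with the bound.\<close>

theorem proposition4p3:
  fixes K :: "('k, 'r) ring_scheme" and g d :: nat
    and M :: "('v::infinite, 'e::infinite, 'k, 'm) rep"
  assumes "field K"
    and "contraction_rep K g M"
    and "smallish TYPE('n) K g d M"
  shows "\<exists>f :: int poly. degree f \<le> d \<and>
    (\<forall>G. genus_graph g G \<longrightarrow>
       vectorspace.fin_dim K (ob M G) \<and>
       int (vectorspace.dim K (ob M G)) \<le> poly f (int (card (arcs G))))"
proof -
  interpret M: contraction_rep K g M by fact
  obtain m F where F: "filtration K g M m F" and "small TYPE('n) K g d (assoc_graded M m F)"
    using assms(3) by (auto simp: smallish_def)
  then obtain N :: "('v, 'e, 'k, 'n) rep" where N: "contraction_rep K g N"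
    and gen: "fin_gen_deg_le K g d N" and sq: "subquotient K g (assoc_graded M m F) N"
    by (auto simp: small_def)
  interpret N: contraction_rep K g N by fact
  obtain S T where S: "subrep K g N S" and T: "subrep K g N T"
    and iso: "rep_iso K g (assoc_graded M m F) (quot_rep (restrict_rep N S) T)"
    using sq by (auto simp: subquotient_def)
  obtain \<eta> where \<eta>: "\<And>G. genus_graph g G \<Longrightarrow>
        \<eta> G \<in> module_hom K (ob (assoc_graded M m F) G) (ob (quot_rep (restrict_rep N S) T) G) \<and>
        bij_betw (\<eta> G) (carrier (ob (assoc_graded M m F) G))
          (carrier (ob (quot_rep (restrict_rep N S) T) G))"
    using iso unfolding rep_iso_def by blast
  obtain r :: nat and Gs v where
    Gs: "\<And>i. i < r \<Longrightarrow> genus_graph g (Gs i) \<and> card (arcs (Gs i)) \<le> d \<and> v i \<in> carrier (ob N (Gs i))"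
    and span: "\<And>G. genus_graph g G \<Longrightarrow>
        module.span K (ob N G) {act N G (Gs i) \<phi> (v i) | i \<phi>. i < r \<and> contraction G (Gs i) \<phi>}
          = carrier (ob N G)"
    using gen unfolding fin_gen_deg_le_def by blast
  \<comment> \<open>The factor in the count of contractions to \<open>Gs i\<close> that does not
    depend on the source. The remaining power of |G| has exponent at most \<open>d\<close>, which
    bounds the degree of \<open>f\<close>.\<close>
  define c where "c i = card (verts (Gs i)) ^ card (verts (Gs i)) * 2 ^ card (arcs (Gs i))" for i
  define f :: "int poly" where "f = (\<Sum>i<r. monom (int (c i)) (card (arcs (Gs i))))"
  have "degree f \<le> d"
    unfolding f_def using Gs by (intro degree_sum_le) (auto intro: order_trans[OF degree_monom_le])
  moreover have "vectorspace.fin_dim K (ob M G) \<and>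
       int (vectorspace.dim K (ob M G)) \<le> poly f (int (card (arcs G)))" if G: "genus_graph g G" for G
  proof -
    \<comment> \<open>The spanning set of \<open>N\<close> at \<open>G\<close> has at most one
      element for each generator and each contraction to its graph.\<close>
    define A where "A = {act N G (Gs i) \<phi> (v i) |i \<phi>. i < r \<and> \<phi> \<in> {\<phi>. contraction G (Gs i) \<phi>}}"
    have fd: "fin_digraph G" "fin_digraph (Gs i)" if "i < r" for i
      using G Gs that by (auto simp: genus_graph_def)
    have finA: "finite A"
      unfolding A_def using fd card_contractions_le(1) by (intro card_indexed_image_le) auto
    have "card A \<le> (\<Sum>i<r. card {\<phi>. contraction G (Gs i) \<phi>})"
      unfolding A_def using fd card_contractions_le(1) by (intro card_indexed_image_le) auto
    also have "\<dots> \<le> (\<Sum>i<r. c i * card (arcs G) ^ card (arcs (Gs i)))"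
      unfolding c_def using fd by (intro sum_mono card_contractions_le(2)) auto
    finally have "int (card A) \<le> int (\<Sum>i<r. c i * card (arcs G) ^ card (arcs (Gs i)))"
      by (simp only: of_nat_le_iff)
    also have "\<dots> = poly f (int (card (arcs G)))"
      by (simp add: f_def poly_sum poly_monom)
    finally have cardA: "int (card A) \<le> poly f (int (card (arcs G)))" .
    have A: "A \<subseteq> carrier (ob N G)"
    proof -
      have "act N G (Gs i) \<phi> (v i) \<in> carrier (ob N G)" if "i < r" "contraction G (Gs i) \<phi>" for i \<phi>
        using module_hom_closed[OF N.act_hom[OF G _ that(2)]] Gs[OF that(1)] by auto
      then show ?thesis by (auto simp: A_def)
    qed
    have spanA: "module.span K (ob N G) A = carrier (ob N G)"
      using span[OF G] by (simp add: A_def)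
    interpret filtered_module K "ob M G" m "\<lambda>i. F i G"
      using M.ob_module[OF G] F G
      by (auto simp: filtered_module_def filtered_module_axioms_def filtration_def subrep_def)
    have NG: "vectorspace K (ob N G)"
      using N.ob_module[OF G] \<open>field K\<close> by (simp add: vectorspace_def)
    have "vectorspace.fin_dim K (ob M G) \<and> vectorspace.dim K (ob M G) \<le> card A"
    proof (rule dim_le_of_gr_subquotient[OF \<open>field K\<close> NG finA A spanA])
      show "submodule K (S G) (ob N G)" "submodule K (T G) (ob N G)"
        using S T G by (auto simp: subrep_def)
      show "\<eta> G \<in> module_hom K (gr_module (ob M G) m (\<lambda>i. F i G))
          (quot_module ((ob N G)\<lparr>carrier := S G\<rparr>) (T G))"
        "bij_betw (\<eta> G) (carrier (gr_module (ob M G) m (\<lambda>i. F i G)))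
          (carrier (quot_module ((ob N G)\<lparr>carrier := S G\<rparr>) (T G)))"
        using \<eta>[OF G] by (simp_all add: assoc_graded_def dsum_rep_def quot_rep_def restrict_rep_def)
    qed
    then show ?thesis using cardA by auto
  qed
  ultimately show ?thesis by blast
qed

end
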